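(* Let $(m,n)$ and $(m',n')$ be two pairs of integers with $n>m>0$ and $n'>m'>0$. Then $(m,n)\sim(m',n')$ if and only if $\Gamma^{(m,n)}$ and $\Gamma^{(m',n')}$ are isomorphic as tropical curves.
   Context: Euclidean sequence. For integers $n>m>0$ with $c=\gcd(m,n)$, put $l_0=n$, $l_1=m$, $l_j=l_{j-2}-l_{j-1}\lfloor l_{j-2}/l_{j-1}\rfloor$ for $2\le j\le r+1$, where $r$ is determined by $l_0>l_1>\dots>l_r=c>l_{r+1}=0$. Put $k_j=\lfloor l_{j-1}/l_j\rfloor$ for $j=1,\dots,r$ (so $k_r\ge 2$). For the pair $(m',n')$ denote the corresponding data by $l'_j$, $r'$, $k'_j=\lfloor l'_{j-1}/l'_j\rfloor$. Equivalence. $(m,n)\sim(m',n')$ means that $r=r'$ and $k_j=k'_j$ for every $j=1,\dots,r$. Tropical curves here are finite graphs, possibly with legs (half-edges attached to a single vertex), with a positive real length on every edge and every leg. An isomorphism of tropical curves is an isomorphism of the underlying graphs with legs (bijections on vertices, edges and legs compatible with incidence) that preserves lengths. The contact tropical curve $\Gamma^{(m,n)}$ of the pair $(m,n)$ has $r+2$ vertices $C_*,E_*,A^1_1,\dots,A^1_r$. If $r>1$, its edges are: $C_*E_*$ of length $1$; $E_*A^1_r$ of length $1$; $E_*A^1_{r-1}$ of length $k_r$; and $A^1_{j+1}A^1_{j-1}$ of length $k_j$ for every $j=2,\dots,r-1$; moreover, if $k_1>1$ there is exactly one leg, attached to $A^1_2$, of length $k_1-1$, and if $k_1=1$ there is no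 leg. If $r=1$, its edges are $C_*E_*$ and $E_*A^1_1$, both of length $1$, and there is exactly one leg, attached to $E_*$, of length $k_1-1$. *)

theory Defs
  imports Complex_Main
begin

fun eucl_seq :: "int \<Rightarrow> int \<Rightarrow> nat \<Rightarrow> int" where
  "eucl_seq m n 0 = n"
| "eucl_seq m n (Suc 0) = m"
| "eucl_seq m n (Suc (Suc j)) =
     eucl_seq m n j - eucl_seq m n (Suc j) * (eucl_seq m n j div eucl_seq m n (Suc j))"

text \<open>The recursion continues past the first zero (with junk values, as \<open>x div 0 = 0\<close>); only the
  indices up to \<open>r + 1\<close> are meaningful, where \<open>r\<close> is the following number.\<close>

definition is_eucl_length :: "int \<Rightarrow> int \<Rightarrow> nat \<Rightarrow> bool" where
  "is_eucl_length m n r \<longleftrightarrow>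
     (\<forall>j\<le>r. eucl_seq m n (Suc j) < eucl_seq m n j) \<and>
     eucl_seq m n r = gcd m n \<and> eucl_seq m n (Suc r) = 0"

definition eucl_length :: "int \<Rightarrow> int \<Rightarrow> nat" where
  "eucl_length m n = (THE r. is_eucl_length m n r)"

text \<open>The partial quotients \<open>k\<^sub>j\<close>, meaningful for \<open>1 \<le> j \<le> r\<close>; \<open>div\<close> on integers rounds down.\<close>

definition eucl_quot :: "int \<Rightarrow> int \<Rightarrow> nat \<Rightarrow> int" where
  "eucl_quot m n j = eucl_seq m n (j - 1) div eucl_seq m n j"

definition pair_equiv :: "int \<times> int \<Rightarrow> int \<times> int \<Rightarrow> bool" where
  "pair_equiv = (\<lambda>(m, n) (m', n').
     eucl_length m n = eucl_length m' n' \<and>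
     (\<forall>j\<in>{1..eucl_length m n}. eucl_quot m n j = eucl_quot m' n' j))"

text \<open>The endpoints of an edge form an unordered pair, given as a set with two elements, or with one
  element for a loop. Parallel edges are allowed, as edges have their own type.\<close>

record ('v, 'e, 'l) tropical_graph =
  verts :: "'v set"
  edges :: "'e set"
  legs :: "'l set"
  ends :: "'e \<Rightarrow> 'v set"
  leg_vertex :: "'l \<Rightarrow> 'v"
  edge_length :: "'e \<Rightarrow> real"
  leg_length :: "'l \<Rightarrow> real"

definition tropical_curve :: "('v, 'e, 'l) tropical_graph \<Rightarrow> bool" where
  "tropical_curve G \<longleftrightarrow>
     finite (verts G) \<and> finite (edges G) \<and> finite (legs G) \<and>
     (\<forall>e\<in>edges G. \<exists>u\<in>verts G. \<exists>v\<in>verts G. ends G e = {u, v}) \<and>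
     (\<forall>l\<in>legs G. leg_vertex G l \<in> verts G) \<and>
     (\<forall>e\<in>edges G. edge_length G e > 0) \<and>
     (\<forall>l\<in>legs G. leg_length G l > 0)"

definition tropical_isomorphism ::
  "('v, 'e, 'l) tropical_graph \<Rightarrow> ('w, 'f, 'k) tropical_graph \<Rightarrow>
   ('v \<Rightarrow> 'w) \<Rightarrow> ('e \<Rightarrow> 'f) \<Rightarrow> ('l \<Rightarrow> 'k) \<Rightarrow> bool" where
  "tropical_isomorphism G H f g h \<longleftrightarrow>
     bij_betw f (verts G) (verts H) \<and>
     bij_betw g (edges G) (edges H) \<and>
     bij_betw h (legs G) (legs H) \<and>
     (\<forall>e\<in>edges G. ends H (g e) = f ` ends G e) \<and>
     (\<forall>l\<in>legs G. leg_vertex H (h l) = f (leg_vertex G l)) \<and>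
     (\<forall>e\<in>edges G. edge_length H (g e) = edge_length G e) \<and>
     (\<forall>l\<in>legs G. leg_length H (h l) = leg_length G l)"

definition tropical_isomorphic ::
  "('v, 'e, 'l) tropical_graph \<Rightarrow> ('w, 'f, 'k) tropical_graph \<Rightarrow> bool" where
  "tropical_isomorphic G H \<longleftrightarrow> (\<exists>f g h. tropical_isomorphism G H f g h)"

datatype contact_vertex = C_star | E_star | A_vert nat

text \<open>\<open>CE\<close> is \<open>C\<^sub>*E\<^sub>*\<close>, \<open>EA_last\<close> is \<open>E\<^sub>*A\<^sub>r\<close>, \<open>EA_prev\<close> is \<open>E\<^sub>*A\<^sub>r\<^sub>-\<^sub>1\<close>, and \<open>AA j\<close> is \<open>A\<^sub>j\<^sub>+\<^sub>1A\<^sub>j\<^sub>-\<^sub>1\<close>.\<close>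

datatype contact_edge = CE | EA_last | EA_prev | AA nat

definition contact_curve ::
  "int \<Rightarrow> int \<Rightarrow> (contact_vertex, contact_edge, unit) tropical_graph" where
  "contact_curve m n =
    (let r = eucl_length m n; k = eucl_quot m n in
     \<lparr> verts = {C_star, E_star} \<union> A_vert ` {1..r},
       edges = (if r > 1 then {CE, EA_last, EA_prev} \<union> AA ` {2..r - 1} else {CE, EA_last}),
       legs = (if r > 1 \<and> k 1 = 1 then {} else {()}),
       ends = (\<lambda>e. case e of
           CE \<Rightarrow> {C_star, E_star}
         | EA_last \<Rightarrow> {E_star, A_vert r}
         | EA_prev \<Rightarrow> {E_star, A_vert (r - 1)}
         | AA j \<Rightarrow> {A_vert (j + 1), A_vert (j - 1)}),
       leg_vertex = (\<lambda>_. if r > 1 then A_vert 2 else E_star),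
       edge_length = (\<lambda>e. case e of
           CE \<Rightarrow> 1
         | EA_last \<Rightarrow> 1
         | EA_prev \<Rightarrow> of_int (k r)
         | AA j \<Rightarrow> of_int (k j)),
       leg_length = (\<lambda>_. of_int (k 1 - 1)) \<rparr>)"

text \<open>The definite description in \<^const>\<open>eucl_length\<close> denotes, and the contact curves are tropical
  curves.\<close>

lemma eucl_seq_mod: "eucl_seq m n (Suc (Suc j)) = eucl_seq m n j mod eucl_seq m n (Suc j)"
  by (simp add: minus_mult_div_eq_mod)

lemma eucl_seq_gcd: "gcd (eucl_seq m n (Suc j)) (eucl_seq m n j) = gcd m n"
proof (induction j)
  case (Suc j)
  then show ?case
    unfolding eucl_seq_mod by (metis gcd.commute gcd_red_int)
qed simp

lemma ex_is_eucl_length: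
  assumes "n > m" "m > 0"
  shows "\<exists>r. is_eucl_length m n r"
proof -
  let ?l = "eucl_seq m n"
  have "\<exists>r. ?l (Suc r) \<le> 0"
  proof (rule ccontr)
    assume "\<nexists>r. ?l (Suc r) \<le> 0"
    then have pos: "?l (Suc r) > 0" for r by (meson not_le)
    have dec: "?l (Suc (Suc r)) < ?l (Suc r)" for r
      unfolding eucl_seq_mod using pos by (rule pos_mod_bound)
    have "?l (Suc r) \<le> m - int r" for r
    proof (induction r)
      case (Suc r)
      then show ?case using dec[of r] by linarith
    qed simp
    from this[of "nat m"] pos[of "nat m"] assms show False by simp
  qed
  define r where "r = (LEAST r. ?l (Suc r) \<le> 0)"
  have le: "?l (Suc r) \<le> 0"
    unfolding r_def using \<open>\<exists>r. ?l (Suc r) \<le> 0\<close> by (rule LeastI_ex)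
  have pos: "?l j > 0" if "j \<le> r" for j
  proof (cases j)
    case 0
    then show ?thesis using assms by simp
  next
    case (Suc i)
    then have "i < (LEAST r. ?l (Suc r) \<le> 0)" using that by (simp add: r_def)
    then show ?thesis using not_less_Least Suc by fastforce
  qed
  have dec: "?l (Suc j) < ?l j" if "j \<le> r" for j
  proof (cases j)
    case 0
    then show ?thesis using assms by simp
  next
    case (Suc i)
    then show ?thesis using pos[OF that] unfolding Suc eucl_seq_mod by (intro pos_mod_bound)
  qed
  have "r \<noteq> 0" using le assms by (cases r) auto
  then obtain i where i: "r = Suc i" by (cases r) auto
  have "?l (Suc r) \<ge> 0"
    using pos[of r] unfolding i eucl_seq_mod by simp
  with le have z: "?l (Suc r) = 0" by simp
  moreover have "?l r = gcd m n"
    using eucl_seq_gcd[of m n r] z pos[of r] by simp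
  ultimately show ?thesis using dec by (auto simp: is_eucl_length_def)
qed

lemma is_eucl_length_unique:
  assumes "n > m" "m > 0" "is_eucl_length m n r" "is_eucl_length m n s"
  shows "r = s"
proof -
  have False if rs: "is_eucl_length m n r" "is_eucl_length m n s" "r < s" for r s
  proof -
    have "eucl_seq m n (Suc (Suc r)) < eucl_seq m n (Suc r)"
      using rs unfolding is_eucl_length_def by (meson Suc_leI)
    moreover have "eucl_seq m n (Suc (Suc r)) = gcd m n" "eucl_seq m n (Suc r) = 0"
      using rs by (simp_all add: is_eucl_length_def)
    ultimately show False by (metis gcd_ge_0_int not_less)
  qed
  with assms show ?thesis by (meson linorder_neqE_nat)
qed

lemma is_eucl_length_eucl_length:
  assumes "n > m" "m > 0"
  shows "is_eucl_length m n (eucl_length m n)"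
  unfolding eucl_length_def
  using ex_is_eucl_length[OF assms] is_eucl_length_unique[OF assms] by (metis theI)

lemma tropical_curve_contact_curve:
  assumes "n > m" "m > 0"
  shows "tropical_curve (contact_curve m n)"
proof -
  define r where "r = eucl_length m n"
  define k where "k = eucl_quot m n"
  let ?l = "eucl_seq m n"
  have dec: "?l (Suc j) < ?l j" if "j \<le> r" for j
    using is_eucl_length_eucl_length[OF assms] that by (auto simp: r_def is_eucl_length_def)
  have z: "?l (Suc r) = 0"
    using is_eucl_length_eucl_length[OF assms] by (simp add: r_def is_eucl_length_def)
  have nonneg: "?l j \<ge> 0" if "j \<le> Suc r" for j
    using that
  proof (induction j rule: inc_induct)
    case base
    then show ?case using z by simp
  next
    case (step i)
    then show ?case using dec[of i] by simp
  qed
  have pos: "?l j > 0" if "j \<le> r" for j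
    using dec[OF that] nonneg[of "Suc j"] that by simp
  have r: "r \<ge> 1" using z assms by (cases r) auto
  have kpos: "k j \<ge> 1" if "1 \<le> j" "j \<le> r" for j
  proof -
    have "?l j \<le> ?l (j - 1)" using dec[of "j - 1"] that by (cases j) auto
    then show ?thesis
      using pos[of j] that by (simp add: k_def eucl_quot_def pos_imp_zdiv_pos_iff int_one_le_iff_zero_less)
  qed
  have k1: "k 1 \<ge> 2" if "r = 1"
  proof -
    have "n mod m = 0" using z that by (simp add: minus_mult_div_eq_mod)
    then have "m * k 1 = n" by (auto simp: k_def eucl_quot_def)
    then have "k 1 \<noteq> 1" using assms by auto
    then show ?thesis using kpos[of 1] that by simp
  qed
  have kr: "real_of_int (k j) > 0" if "1 \<le> j" "j \<le> r" for j
    using kpos[OF that] by simp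
  have k1_leg: "k 1 > 1" if "\<not> (r > 1 \<and> k 1 = 1)"
    using that r kpos[of 1] k1 by (cases "r = 1") auto
  let ?G = "contact_curve m n"
  note curve_def = contact_curve_def Let_def r_def[symmetric] k_def[symmetric]
  have vertsI: "C_star \<in> verts ?G" "E_star \<in> verts ?G"
    "A_vert j \<in> verts ?G" if "1 \<le> j" "j \<le> r" for j
    using that by (auto simp: curve_def)
  have edge_cases: "e = CE \<or> e = EA_last \<or> (e = EA_prev \<and> r > 1) \<or> (\<exists>j. e = AA j \<and> 2 \<le> j \<and> j \<le> r - 1)"
    if "e \<in> edges ?G" for e
    using that by (auto simp: curve_def split: if_splits)
  have "\<exists>u\<in>verts ?G. \<exists>v\<in>verts ?G. ends ?G e = {u, v}" if e: "e \<in> edges ?G" for e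
    using edge_cases[OF e]
  proof (elim disjE exE conjE)
    assume "e = CE"
    then have "ends ?G e = {C_star, E_star}" by (simp add: curve_def)
    then show ?thesis using vertsI r by blast
  next
    assume "e = EA_last"
    then have "ends ?G e = {E_star, A_vert r}" by (simp add: curve_def)
    then show ?thesis using vertsI r by blast
  next
    assume "e = EA_prev" "r > 1"
    then have "ends ?G e = {E_star, A_vert (r - 1)}" "1 \<le> r - 1" "r - 1 \<le> r"
      by (simp_all add: curve_def)
    then show ?thesis using vertsI by blast
  next
    fix j assume "e = AA j" "2 \<le> j" "j \<le> r - 1"
    then have "ends ?G e = {A_vert (j + 1), A_vert (j - 1)}"
      "1 \<le> j + 1" "j + 1 \<le> r" "1 \<le> j - 1" "j - 1 \<le> r"
      by (simp_all add: curve_def)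
    then show ?thesis using vertsI by blast
  qed
  moreover have "edge_length ?G e > 0" if "e \<in> edges ?G" for e
    using edge_cases[OF that] r kr by (auto simp: curve_def)
  moreover have "leg_vertex ?G l \<in> verts ?G" "leg_length ?G l > 0" if "l \<in> legs ?G" for l
    using that r k1_leg by (auto simp: curve_def split: if_splits)
  moreover have "finite (verts ?G)" "finite (edges ?G)" "finite (legs ?G)"
    by (simp_all add: curve_def)
  ultimately show ?thesis by (simp add: tropical_curve_def)
qed

end

theory Submission
  imports Defs
begin

text \<open>The curve \<open>\<Gamma>\<close> of a pair is determined by \<open>r\<close> and the quotients \<open>k\<^sub>1, \<dots>, k\<^sub>r\<close>, so equivalent
  pairs have isomorphic curves, through the identity.

  Conversely, \<open>\<Gamma>\<close> has \<open>r + 2\<close> vertices, so an isomorphism determines \<open>r\<close>; and its leg, or the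
  absence of one, determines \<open>k\<^sub>1\<close>. For \<open>r \<ge> 2\<close> the other quotients are edge lengths, and they can be
  read off because \<open>\<Gamma>\<close> is a tree with a single branching vertex \<open>E\<^sub>*\<close>, from which three branches
  leave: the single vertex \<open>C\<^sub>*\<close>, the path \<open>A\<^sub>r, A\<^sub>r\<^sub>-\<^sub>2, \<dots>\<close> and the path \<open>A\<^sub>r\<^sub>-\<^sub>1, A\<^sub>r\<^sub>-\<^sub>3, \<dots>\<close>. An
  isomorphism fixes \<open>E\<^sub>*\<close>, as only this vertex lies on three edges. It fixes the edge
  \<open>E\<^sub>*A\<^sub>r\<^sub>-\<^sub>1\<close>, as its length \<open>k\<^sub>r\<close> is at least \<open>2\<close> while the other two edges at \<open>E\<^sub>*\<close> have length
  \<open>1\<close>. For \<open>r \<ge> 3\<close> it cannot take \<open>A\<^sub>r\<close> to \<open>C\<^sub>*\<close>, as of these two only the latter is an end of the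
  tree. So it fixes the first edge of both paths and then, going outwards, all their edges
  (\<open>isomorphism_fixes_inward_edge\<close>). For \<open>r = 2\<close> the vertices \<open>A\<^sub>2\<close> and \<open>C\<^sub>*\<close> can be exchanged when
  there is no leg, but then \<open>E\<^sub>*A\<^sub>1\<close> is the only edge whose length is needed.\<close>

section \<open>The Euclidean sequence\<close>

lemma eucl_length_pos:
  assumes "n > m" "m > 0"
  shows "eucl_length m n \<ge> 1"
proof (rule ccontr)
  assume "\<not> ?thesis"
  then have "eucl_length m n = 0" by simp
  with is_eucl_length_eucl_length[OF assms] assms show False
    by (simp add: is_eucl_length_def)
qed

text \<open>The last division has remainder \<open>0\<close>, so \<open>k\<^sub>r l\<^sub>r = l\<^sub>r\<^sub>-\<^sub>1 > l\<^sub>r\<close>.\<close>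

lemma last_eucl_quot_ge_2:
  assumes "n > m" "m > 0"
  shows "eucl_quot m n (eucl_length m n) \<ge> 2"
proof -
  obtain i where i: "eucl_length m n = Suc i"
    using eucl_length_pos[OF assms] by (cases "eucl_length m n") auto
  let ?a = "eucl_seq m n i" and ?b = "eucl_seq m n (Suc i)"
  have len: "is_eucl_length m n (Suc i)"
    using is_eucl_length_eucl_length[OF assms] i by simp
  then have dec: "?b < ?a" and gcd: "?b = gcd m n" and zero: "eucl_seq m n (Suc (Suc i)) = 0"
    unfolding is_eucl_length_def by (meson le_SucI order_refl)+
  from zero have zero: "?a = ?b * (?a div ?b)" by simp
  have "?b > 0" using gcd assms by simp
  moreover have "?b * 1 < ?b * (?a div ?b)" using dec zero by linarith
  ultimately have "1 < ?a div ?b"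
    by (simp only: mult_less_cancel_left_pos)
  then show ?thesis by (simp add: i eucl_quot_def)
qed

section \<open>Incidence in the contact curve\<close>

lemma verts_contact_curve:
  "verts (contact_curve m n) = {C_star, E_star} \<union> A_vert ` {1..eucl_length m n}"
  by (simp add: contact_curve_def Let_def)

lemma edges_contact_curve:
  "edges (contact_curve m n) =
    (if eucl_length m n > 1 then {CE, EA_last, EA_prev} \<union> AA ` {2..eucl_length m n - 1}
     else {CE, EA_last})"
  by (simp add: contact_curve_def Let_def)

lemma legs_contact_curve:
  "legs (contact_curve m n) = (if eucl_length m n > 1 \<and> eucl_quot m n 1 = 1 then {} else {()})"
  by (simp add: contact_curve_def Let_def)

lemma leg_vertex_contact_curve:
  "leg_vertex (contact_curve m n) l = (if eucl_length m n > 1 then A_vert 2 else E_star)"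
  by (simp add: contact_curve_def Let_def)

lemma leg_length_contact_curve:
  "leg_length (contact_curve m n) l = of_int (eucl_quot m n 1 - 1)"
  by (simp add: contact_curve_def Let_def)

lemma ends_contact_curve:
  "ends (contact_curve m n) CE = {C_star, E_star}"
  "ends (contact_curve m n) EA_last = {E_star, A_vert (eucl_length m n)}"
  "ends (contact_curve m n) EA_prev = {E_star, A_vert (eucl_length m n - 1)}"
  "ends (contact_curve m n) (AA j) = {A_vert (j + 1), A_vert (j - 1)}"
  by (simp_all add: contact_curve_def Let_def)

lemma edge_length_contact_curve:
  "edge_length (contact_curve m n) CE = 1"
  "edge_length (contact_curve m n) EA_last = 1"
  "edge_length (contact_curve m n) EA_prev = of_int (eucl_quot m n (eucl_length m n))"
  "edge_length (contact_curve m n) (AA j) = of_int (eucl_quot m n j)"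
  by (simp_all add: contact_curve_def Let_def)

lemma card_verts_contact_curve: "card (verts (contact_curve m n)) = eucl_length m n + 2"
proof -
  have "card (A_vert ` {1..eucl_length m n}) = eucl_length m n"
    by (subst card_image) (auto simp: inj_on_def)
  moreover have "C_star \<notin> insert E_star (A_vert ` {1..eucl_length m n})"
    "E_star \<notin> A_vert ` {1..eucl_length m n}" by auto
  ultimately show ?thesis by (simp add: verts_contact_curve)
qed

lemma contact_edge_at_C:
  assumes "e \<in> edges (contact_curve m n)" "C_star \<in> ends (contact_curve m n) e"
  shows "e = CE"
  using assms by (auto simp: edges_contact_curve ends_contact_curve split: if_splits)

lemma contact_edge_at_E:
  assumes "e \<in> edges (contact_curve m n)" "E_star \<in> ends (contact_curve m n) e"
  shows "e \<in> {CE, EA_last, EA_prev}"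
  using assms by (auto simp: edges_contact_curve ends_contact_curve split: if_splits)

text \<open>In the tree rooted at \<open>E\<^sub>*\<close>, this is the edge from \<open>A\<^sub>i\<close> towards the root.\<close>

definition inward_edge :: "nat \<Rightarrow> nat \<Rightarrow> contact_edge" where
  "inward_edge r i = (if i = r then EA_last else if i = r - 1 then EA_prev else AA (i + 1))"

text \<open>The only other edge at \<open>A\<^sub>i\<close> leads outwards to \<open>A\<^sub>i\<^sub>-\<^sub>2\<close>.\<close>

lemma contact_edge_at_A:
  assumes "eucl_length m n = r" "r \<ge> 1"
    and "e \<in> edges (contact_curve m n)" "A_vert i \<in> ends (contact_curve m n) e"
  shows "e = inward_edge r i \<or> e = AA (i - 1)"
  using assms
  by (auto simp: edges_contact_curve ends_contact_curve inward_edge_def split: if_splits)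

lemma edge_length_inward_edge:
  assumes "eucl_length m n = r" "1 \<le> i" "i < r"
  shows "edge_length (contact_curve m n) (inward_edge r i) = of_int (eucl_quot m n (i + 1))"
  using assms by (auto simp: inward_edge_def edge_length_contact_curve)

lemma inward_edge_in_edges:
  assumes "eucl_length m n = r" "1 \<le> i" "i < r"
  shows "inward_edge r i \<in> edges (contact_curve m n)"
  using assms by (auto simp: inward_edge_def edges_contact_curve)

section \<open>Equivalent pairs have isomorphic curves\<close>

text \<open>The two records may differ on arguments that are not edges, so they need not be equal.\<close>

lemma pair_equiv_imp_tropical_isomorphic:
  assumes pos: "eucl_length m n \<ge> 1" and "pair_equiv (m, n) (m', n')"
  shows "tropical_isomorphic (contact_curve m n) (contact_curve m' n')"
proof -
  let ?G = "contact_curve m n" and ?H = "contact_curve m' n'"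
  have r: "eucl_length m' n' = eucl_length m n"
    using assms(2) by (simp add: pair_equiv_def)
  have k: "eucl_quot m' n' j = eucl_quot m n j" if "1 \<le> j" "j \<le> eucl_length m n" for j
    using assms(2) that by (simp add: pair_equiv_def)
  have k1: "eucl_quot m' n' 1 = eucl_quot m n 1" using k pos by simp
  have "verts ?H = verts ?G" "edges ?H = edges ?G" "legs ?H = legs ?G"
    using k1 by (simp_all add: verts_contact_curve edges_contact_curve legs_contact_curve r)
  moreover have "ends ?H e = ends ?G e" for e
    by (cases e) (simp_all add: ends_contact_curve r)
  moreover have "edge_length ?H e = edge_length ?G e" if "e \<in> edges ?G" for e
    using that pos k
    by (auto simp: edges_contact_curve edge_length_contact_curve r split: if_splits)
  moreover have "leg_vertex ?H l = leg_vertex ?G l" "leg_length ?H l = leg_length ?G l" for l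
    using k1 by (simp_all add: leg_vertex_contact_curve leg_length_contact_curve r)
  ultimately have "tropical_isomorphism ?G ?H id id id"
    by (simp add: tropical_isomorphism_def)
  then show ?thesis by (auto simp: tropical_isomorphic_def)
qed

section \<open>Isomorphic curves come from equivalent pairs\<close>

lemma isomorphism_eucl_length_eq:
  assumes "tropical_isomorphism (contact_curve m n) (contact_curve m' n') f g h"
  shows "eucl_length m' n' = eucl_length m n"
proof -
  have "card (verts (contact_curve m n)) = card (verts (contact_curve m' n'))"
    using assms bij_betw_same_card by (auto simp: tropical_isomorphism_def)
  then show ?thesis by (simp add: card_verts_contact_curve)
qed

lemma isomorphism_first_eucl_quot_eq:
  assumes iso: "tropical_isomorphism (contact_curve m n) (contact_curve m' n') f g h"
  shows "eucl_quot m' n' 1 = eucl_quot m n 1"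
proof (cases "legs (contact_curve m n) = {}")
  case True
  moreover have "bij_betw h (legs (contact_curve m n)) (legs (contact_curve m' n'))"
    using iso by (simp add: tropical_isomorphism_def)
  ultimately have "legs (contact_curve m' n') = {}"
    by (simp add: bij_betw_def)
  with True show ?thesis by (simp add: legs_contact_curve split: if_splits)
next
  case False
  then have "() \<in> legs (contact_curve m n)" by auto
  then have "leg_length (contact_curve m' n') (h ()) = leg_length (contact_curve m n) ()"
    using iso by (simp add: tropical_isomorphism_def)
  then show ?thesis by (simp add: leg_length_contact_curve)
qed

lemma isomorphism_fixes_E:
  assumes iso: "tropical_isomorphism (contact_curve m n) (contact_curve m' n') f g h"
    and "eucl_length m n \<ge> 2"
  shows "f E_star = E_star"
proof -
  define r where "r = eucl_length m n"
  let ?G = "contact_curve m n" and ?H = "contact_curve m' n'"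
  let ?S = "{CE, EA_last, EA_prev}"
  have r': "eucl_length m' n' = r" using isomorphism_eucl_length_eq[OF iso] by (simp add: r_def)
  have r2: "r \<ge> 2" using assms(2) by (simp add: r_def)
  have S: "?S \<subseteq> edges ?G" using r2 by (auto simp: edges_contact_curve r_def)
  have inj: "inj_on g (edges ?G)" and edge: "\<And>e. e \<in> edges ?G \<Longrightarrow> g e \<in> edges ?H"
    using iso by (auto simp: tropical_isomorphism_def bij_betw_def)
  have inc: "f E_star \<in> ends ?H (g e)" if "e \<in> ?S" for e
  proof -
    have "ends ?H (g e) = f ` ends ?G e"
      using iso S that by (auto simp: tropical_isomorphism_def)
    then show ?thesis using that by (auto simp: ends_contact_curve)
  qed
  have "card (g ` ?S) = card ?S"
    by (intro card_image inj_on_subset[OF inj S])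
  then have three: "card (g ` ?S) = 3" by simp
  have few: False if "g ` ?S \<subseteq> {a, b}" for a b
  proof -
    have "card (g ` ?S) \<le> card {a, b}" using that by (intro card_mono) auto
    also have "\<dots> \<le> 2" by (simp add: card_insert_if)
    finally show False using three by simp
  qed
  show ?thesis
  proof (cases "f E_star")
    case C_star
    have "g e = CE" if "e \<in> ?S" for e
      using contact_edge_at_C[OF edge, of e] inc[OF that] S that C_star by auto
    then have "g ` ?S \<subseteq> {CE, CE}" by blast
    then show ?thesis using few by blast
  next
    case (A_vert i)
    have "g e \<in> {inward_edge r i, AA (i - 1)}" if "e \<in> ?S" for e
      using contact_edge_at_A[OF r' _ edge, of e i] inc[OF that] S that r2 A_vert by auto
    then have "g ` ?S \<subseteq> {inward_edge r i, AA (i - 1)}" by blast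
    then show ?thesis using few by blast
  qed
qed

text \<open>The isomorphism also fixes the vertices, which is what carries the induction outwards along the
  two paths. The bound \<open>i < r\<close> leaves out \<open>E\<^sub>*A\<^sub>r\<close>, which can be exchanged with \<open>C\<^sub>*E\<^sub>*\<close> for
  \<open>r = 2\<close> and \<open>k\<^sub>1 = 1\<close>.\<close>

lemma isomorphism_fixes_inward_edge:
  assumes iso: "tropical_isomorphism (contact_curve m n) (contact_curve m' n') f g h"
    and r: "eucl_length m n = r"
    and last: "eucl_quot m n r \<ge> 2"
    and i: "1 \<le> i" "i < r"
  shows "f (A_vert i) = A_vert i \<and> g (inward_edge r i) = inward_edge r i"
proof -
  let ?G = "contact_curve m n" and ?H = "contact_curve m' n'"
  let ?fixed = "\<lambda>i. f (A_vert i) = A_vert i \<and> g (inward_edge r i) = inward_edge r i"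
  have r2: "r \<ge> 2" using i by simp
  have r': "eucl_length m' n' = r" using isomorphism_eucl_length_eq[OF iso] r by simp
  have E: "f E_star = E_star" using isomorphism_fixes_E[OF iso] r r2 by simp
  have inj: "g e = g e' \<longleftrightarrow> e = e'" if "e \<in> edges ?G" "e' \<in> edges ?G" for e e'
    using iso that by (meson tropical_isomorphism_def bij_betw_def inj_on_eq_iff)
  have edge: "g e \<in> edges ?H" and ends: "ends ?H (g e) = f ` ends ?G e"
    and len: "edge_length ?H (g e) = edge_length ?G e" if "e \<in> edges ?G" for e
    using iso that by (auto simp: tropical_isomorphism_def bij_betw_def)
  have mem: "CE \<in> edges ?G" "EA_last \<in> edges ?G" "EA_prev \<in> edges ?G"
    using r r2 by (auto simp: edges_contact_curve)
  have prev: "g EA_prev = EA_prev"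
  proof -
    have "E_star \<in> ends ?H (g EA_prev)"
      using ends[OF mem(3)] E by (simp add: ends_contact_curve)
    then have "g EA_prev \<in> {CE, EA_last, EA_prev}"
      by (rule contact_edge_at_E[OF edge[OF mem(3)]])
    moreover have "edge_length ?H (g EA_prev) \<noteq> 1"
      using len[OF mem(3)] last r by (simp add: edge_length_contact_curve)
    ultimately show ?thesis by (auto simp: edge_length_contact_curve)
  qed
  have fixed_prev: "?fixed (r - 1)"
  proof -
    have "{E_star, A_vert (r - 1)} = {f E_star, f (A_vert (r - 1))}"
      using ends[OF mem(3)] prev r r' by (simp add: ends_contact_curve)
    then have "f (A_vert (r - 1)) = A_vert (r - 1)"
      using E by (auto simp: doubleton_eq_iff)
    moreover have "r - 1 \<noteq> r" using r2 by simp
    ultimately show ?thesis using prev by (simp add: inward_edge_def)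
  qed
  have fixed_last: "?fixed r" if "r \<ge> 3"
  proof -
    have AA: "AA (r - 1) \<in> edges ?G" using that r by (auto simp: edges_contact_curve)
    have last_ends: "ends ?H (g EA_last) = {E_star, f (A_vert r)}"
      using ends[OF mem(2)] E r by (simp add: ends_contact_curve)
    then have "g EA_last \<in> {CE, EA_last, EA_prev}"
      using contact_edge_at_E[OF edge[OF mem(2)]] by simp
    moreover have "g EA_last \<noteq> EA_prev"
      using inj[OF mem(2,3)] prev by simp
    \<comment> \<open>Otherwise the further edge \<open>A\<^sub>rA\<^sub>r\<^sub>-\<^sub>2\<close> would go to a second edge at \<open>C\<^sub>*\<close>.\<close>
    moreover have "g EA_last \<noteq> CE"
    proof
      assume CE: "g EA_last = CE"
      then have "f (A_vert r) = C_star"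
        using last_ends by (auto simp: ends_contact_curve doubleton_eq_iff)
      then have "C_star \<in> ends ?H (g (AA (r - 1)))"
        using ends[OF AA] r2 by (simp add: ends_contact_curve)
      then have "g (AA (r - 1)) = CE"
        by (rule contact_edge_at_C[OF edge[OF AA]])
      then show False using CE inj[OF mem(2) AA] by simp
    qed
    ultimately have g: "g EA_last = EA_last" by simp
    then have "f (A_vert r) = A_vert r"
      using last_ends r' by (auto simp: ends_contact_curve doubleton_eq_iff)
    then show ?thesis using g by (simp add: inward_edge_def)
  qed
  have step: "?fixed i" if i: "1 \<le> i" "i + 2 \<le> r" and fixed: "?fixed (i + 2)" for i
  proof -
    have inward: "inward_edge r i = AA (i + 1)" using i by (simp add: inward_edge_def)
    have AA: "AA (i + 1) \<in> edges ?G" using i r by (auto simp: edges_contact_curve)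
    have next_edge: "inward_edge r (i + 2) \<in> edges ?G"
      using i r mem inward_edge_in_edges[OF r, of "i + 2"]
      by (cases "i + 2 = r") (auto simp: inward_edge_def)
    have AA_ends: "ends ?H (g (AA (i + 1))) = {A_vert (i + 2), f (A_vert i)}"
      using ends[OF AA] fixed by (simp add: ends_contact_curve)
    then have "g (AA (i + 1)) = inward_edge r (i + 2) \<or> g (AA (i + 1)) = AA (i + 1)"
      using contact_edge_at_A[OF r' _ edge[OF AA], of "i + 2"] r2 by simp
    moreover have "g (AA (i + 1)) \<noteq> inward_edge r (i + 2)"
      using inj[OF AA next_edge] fixed by (auto simp: inward_edge_def split: if_splits)
    ultimately have g: "g (AA (i + 1)) = AA (i + 1)" by simp
    then have "f (A_vert i) = A_vert i"
      using AA_ends by (auto simp: ends_contact_curve doubleton_eq_iff)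
    then show ?thesis using g inward by simp
  qed
  show ?thesis using i
  proof (induction "r - i" arbitrary: i rule: less_induct)
    case less
    consider "i = r - 1" | "i + 2 = r" | "i + 2 < r" using less.prems by linarith
    then show ?case
    proof cases
      case 1
      then show ?thesis using fixed_prev by simp
    next
      case 2
      then show ?thesis using step[of i] fixed_last less.prems by simp
    next
      case 3
      then show ?thesis using step[of i] less.hyps[of "i + 2"] less.prems by simp
    qed
  qed
qed

lemma tropical_isomorphic_imp_pair_equiv:
  assumes last: "eucl_quot m n (eucl_length m n) \<ge> 2"
    and "tropical_isomorphic (contact_curve m n) (contact_curve m' n')"
  shows "pair_equiv (m, n) (m', n')"
proof -
  obtain f g h where iso: "tropical_isomorphism (contact_curve m n) (contact_curve m' n') f g h"
    using assms(2) by (auto simp: tropical_isomorphic_def)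
  define r where "r = eucl_length m n"
  note r' = isomorphism_eucl_length_eq[OF iso]
  have "eucl_quot m n j = eucl_quot m' n' j" if j: "1 \<le> j" "j \<le> r" for j
  proof (cases "j = 1")
    case True
    then show ?thesis using isomorphism_first_eucl_quot_eq[OF iso] by simp
  next
    case False
    define i where "i = j - 1"
    have i: "1 \<le> i" "i < r" "i + 1 = j" using j False by (auto simp: i_def)
    have "g (inward_edge r i) = inward_edge r i"
      using isomorphism_fixes_inward_edge[OF iso _ _ i(1,2)] last by (simp add: r_def)
    moreover have "edge_length (contact_curve m' n') (g (inward_edge r i)) =
        edge_length (contact_curve m n) (inward_edge r i)"
      using iso inward_edge_in_edges[OF r_def[symmetric] i(1,2)]
      by (simp add: tropical_isomorphism_def)
    ultimately show ?thesis
      using i r' by (simp add: edge_length_inward_edge r_def)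
  qed
  then show ?thesis using r' by (simp add: pair_equiv_def r_def)
qed

theorem theorem3p2p4:
  fixes m n m' n' :: int
  assumes "n > m" and "m > 0" and "n' > m'" and "m' > 0"
  shows "pair_equiv (m, n) (m', n') \<longleftrightarrow>
    tropical_isomorphic (contact_curve m n) (contact_curve m' n')"
  using pair_equiv_imp_tropical_isomorphic[OF eucl_length_pos[OF assms(1,2)]]
    tropical_isomorphic_imp_pair_equiv[OF last_eucl_quot_ge_2[OF assms(1,2)]] by blast

end
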